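(* Let $2\le I\le J$ be integers, let $\mathcal{M}$ be the set of non-negative real $I\times J$ matrices with entries summing to $1$ and non-negative rank at most $2$, and for $1\le j_1<j_2\le J$ let $f_{j_1,j_2}:U'_{j_1,j_2}\to\mathbb{R}^{I\times J}$, $U'_{j_1,j_2}\subset\mathbb{R}^{2I+2J-5}$, be the maps defined in the context. Then $\mathcal{M}$ is covered by the images of these functions; more precisely, $$\bigcup_{1\le j_1<j_2\le J}\mathrm{Im}(f_{j_1,j_2})=\mathcal{M}.$$
   Context: Non-negative rank: for a matrix $P$ with non-negative real entries, $\mathrm{rk}_+(P)$ is the smallest $k$ such that there are non-negative column vectors $v_1,\dots,v_k$ for which every column of $P$ is a linear combination of $v_1,\dots,v_k$ with non-negative coefficients (equivalently, $P$ is a sum of $k$ products $cr^t$ with $c,r$ non-negative vectors). $\mathcal{M}=\{P\in\mathbb{R}_{+}^{I\times J}:\ \mathrm{rk}_+(P)\le 2,\ \sum_{i,j}p_{i,j}=1\}$, where $\mathbb{R}_+=[0,\infty)$. Maps $f_{j_1,j_2}$: set $D=2I+2J-5$ and $N=\{1,\dots,J\}\setminus\{j_1,j_2\}$. A point of $\mathbb{R}^D$ is written $P'=\big((a_i)_{1\le i\le I-1},(b_j)_{j\in N},(c_i)_{1\le i\le I-1},(d_j)_{j\in N},\alpha\big)$. Let $U'_{j_1,j_2}\subset\mathbb{R}^D$ be the set of such points with all of $a_i,b_j,c_i,d_j,\alpha$ in $[0,1]$ and each of $\sum_i a_i,\ \sum_j b_j,\ \sum_i c_i,\ \sum_j d_j$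 in $[0,1]$. Define $$f_{j_1,j_2}(P')=\alpha\,\mathbf{a}\,\mathbf{b}^t+(1-\alpha)\,\mathbf{c}\,\mathbf{d}^t,$$ where $\mathbf{a}=(a_1,\dots,a_{I-1},1-\sum a_i)^t$, $\mathbf{c}=(c_1,\dots,c_{I-1},1-\sum c_i)^t\in\mathbb{R}^I$; $\mathbf{b}\in\mathbb{R}^J$ has entry $1-\sum b_j$ in position $j_1$, entry $0$ in position $j_2$, and entry $b_j$ in position $j$ for $j\in N$; $\mathbf{d}\in\mathbb{R}^J$ has entry $0$ in position $j_1$, entry $1-\sum d_j$ in position $j_2$, and entry $d_j$ in position $j$ for $j\in N$. *)

theory Defs
  imports Complex_Main "Jordan_Normal_Form.Matrix"
begin

text \<open>
  Rows and columns are indexed from 0, as in the matrix library: the row and column indices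
  \<open>1, \<dots>, I\<close> and \<open>1, \<dots>, J\<close> of the mathematical text become \<open>0, \<dots>, I - 1\<close> and \<open>0, \<dots>, J - 1\<close>.
\<close>

text \<open>
  On vectors, \<open>\<le>\<close> is the componentwise order. The set of admissible \<open>k\<close> is nonempty for a
  matrix with non-negative entries (its own columns may be taken); for other matrices
  the value is unspecified.
\<close>
definition nonneg_rank :: "real mat \<Rightarrow> nat" where
  "nonneg_rank P = (LEAST k. \<exists>v :: nat \<Rightarrow> real vec.
     (\<forall>l<k. v l \<in> carrier_vec (dim_row P) \<and> 0\<^sub>v (dim_row P) \<le> v l) \<and>
     (\<forall>j<dim_col P. \<exists>w :: nat \<Rightarrow> real. (\<forall>l<k. 0 \<le> w l) \<and>
        col P j = finsum_vec TYPE(real) (dim_row P) (\<lambda>l. w l \<cdot>\<^sub>v v l) {..<k}))"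

definition mixture_set :: "nat \<Rightarrow> nat \<Rightarrow> real mat set" where
  "mixture_set I J = {P \<in> carrier_mat I J.
     (\<forall>i<I. \<forall>j<J. 0 \<le> P $$ (i, j)) \<and> nonneg_rank P \<le> 2 \<and>
     (\<Sum>i<I. \<Sum>j<J. P $$ (i, j)) = 1}"

definition col_indices :: "nat \<Rightarrow> nat \<Rightarrow> nat \<Rightarrow> nat set" where
  "col_indices J j1 j2 = {..<J} - {j1, j2}"

text \<open>
  The coordinates of a point of \<open>\<real>\<^sup>D\<close>, \<open>D = 2 I + 2 J - 5\<close>, are grouped in the order
  \<open>(a\<^sub>i)\<close>, \<open>(b\<^sub>j)\<close>, \<open>(c\<^sub>i)\<close>, \<open>(d\<^sub>j)\<close>, \<open>\<alpha>\<close>, in blocks of lengths \<open>I - 1\<close>, \<open>J - 2\<close>, \<open>I - 1\<close>, \<open>J - 2\<close>, \<open>1\<close>.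
  The families \<open>b\<close> and \<open>d\<close> are indexed by \<open>N = col_indices J j1 j2\<close>, listed increasingly;
  \<open>col_pos J j1 j2 j\<close> is the (0-based) position of \<open>j\<close> in that list.
\<close>
definition col_pos :: "nat \<Rightarrow> nat \<Rightarrow> nat \<Rightarrow> nat \<Rightarrow> nat" where
  "col_pos J j1 j2 j = card {k \<in> col_indices J j1 j2. k < j}"

definition coord_a :: "real vec \<Rightarrow> nat \<Rightarrow> real" where
  "coord_a x i = x $ i"

definition coord_b :: "nat \<Rightarrow> nat \<Rightarrow> nat \<Rightarrow> nat \<Rightarrow> real vec \<Rightarrow> nat \<Rightarrow> real" where
  "coord_b I J j1 j2 x j = x $ ((I - 1) + col_pos J j1 j2 j)"

definition coord_c :: "nat \<Rightarrow> nat \<Rightarrow> real vec \<Rightarrow> nat \<Rightarrow> real" where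
  "coord_c I J x i = x $ ((I - 1) + (J - 2) + i)"

definition coord_d :: "nat \<Rightarrow> nat \<Rightarrow> nat \<Rightarrow> nat \<Rightarrow> real vec \<Rightarrow> nat \<Rightarrow> real" where
  "coord_d I J j1 j2 x j = x $ ((I - 1) + (J - 2) + (I - 1) + col_pos J j1 j2 j)"

definition coord_alpha :: "nat \<Rightarrow> nat \<Rightarrow> real vec \<Rightarrow> real" where
  "coord_alpha I J x = x $ ((I - 1) + (J - 2) + (I - 1) + (J - 2))"

definition U' :: "nat \<Rightarrow> nat \<Rightarrow> nat \<Rightarrow> nat \<Rightarrow> real vec set" where
  "U' I J j1 j2 = {x \<in> carrier_vec (2 * I + 2 * J - 5).
     (\<forall>i<I - 1. coord_a x i \<in> {0..1}) \<and>
     (\<forall>j\<in>col_indices J j1 j2. coord_b I J j1 j2 x j \<in> {0..1}) \<and>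
     (\<forall>i<I - 1. coord_c I J x i \<in> {0..1}) \<and>
     (\<forall>j\<in>col_indices J j1 j2. coord_d I J j1 j2 x j \<in> {0..1}) \<and>
     coord_alpha I J x \<in> {0..1} \<and>
     (\<Sum>i<I - 1. coord_a x i) \<in> {0..1} \<and>
     (\<Sum>j\<in>col_indices J j1 j2. coord_b I J j1 j2 x j) \<in> {0..1} \<and>
     (\<Sum>i<I - 1. coord_c I J x i) \<in> {0..1} \<and>
     (\<Sum>j\<in>col_indices J j1 j2. coord_d I J j1 j2 x j) \<in> {0..1}}"

definition vec_a :: "nat \<Rightarrow> real vec \<Rightarrow> real vec" where
  "vec_a I x = vec I (\<lambda>i. if i < I - 1 then coord_a x i else 1 - (\<Sum>k<I - 1. coord_a x k))"

definition vec_c :: "nat \<Rightarrow> nat \<Rightarrow> real vec \<Rightarrow> real vec" where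
  "vec_c I J x =
     vec I (\<lambda>i. if i < I - 1 then coord_c I J x i else 1 - (\<Sum>k<I - 1. coord_c I J x k))"

definition vec_b :: "nat \<Rightarrow> nat \<Rightarrow> nat \<Rightarrow> nat \<Rightarrow> real vec \<Rightarrow> real vec" where
  "vec_b I J j1 j2 x = vec J (\<lambda>j.
     if j = j1 then 1 - (\<Sum>k\<in>col_indices J j1 j2. coord_b I J j1 j2 x k)
     else if j = j2 then 0
     else coord_b I J j1 j2 x j)"

definition vec_d :: "nat \<Rightarrow> nat \<Rightarrow> nat \<Rightarrow> nat \<Rightarrow> real vec \<Rightarrow> real vec" where
  "vec_d I J j1 j2 x = vec J (\<lambda>j.
     if j = j1 then 0
     else if j = j2 then 1 - (\<Sum>k\<in>col_indices J j1 j2. coord_d I J j1 j2 x k)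
     else coord_d I J j1 j2 x j)"

definition outer_product :: "real vec \<Rightarrow> real vec \<Rightarrow> real mat" where
  "outer_product u v = transpose_mat (mat_of_row u) * mat_of_row v"

definition f_map :: "nat \<Rightarrow> nat \<Rightarrow> nat \<Rightarrow> nat \<Rightarrow> real vec \<Rightarrow> real mat" where
  "f_map I J j1 j2 x =
     coord_alpha I J x \<cdot>\<^sub>m outer_product (vec_a I x) (vec_b I J j1 j2 x) +
     (1 - coord_alpha I J x) \<cdot>\<^sub>m outer_product (vec_c I J x) (vec_d I J j1 j2 x)"

end

(* The columns of a matrix of non-negative rank at most 2 have non-negative coordinates in R^2
   with respect to two generators. A finitely generated cone in the quadrant is spanned by two of its
   generators, so all columns of P are non-negative combinations of two columns j1 and j2 of P
   itself: P = p_j1 s^t + p_j2 t^t with s_j2 = t_j1 = 0 and s_j1 = t_j2 = 1. Normalising the four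
   vectors gives a point of the parameter domain. *)
theory Submission
  imports Defs "HOL-Analysis.Product_Vector"
begin

section \<open>Cones with two generators\<close>

text \<open>The generators may be zero or parallel, so half-lines and the origin count as cones too;
  matrices with zero or proportional columns then follow the general argument.\<close>

definition cone2 :: "'a::real_vector \<Rightarrow> 'a \<Rightarrow> 'a set" where
  "cone2 p q = {s *\<^sub>R p + t *\<^sub>R q | s t. 0 \<le> s \<and> 0 \<le> t}"

lemma cone2I: "0 \<le> s \<Longrightarrow> 0 \<le> t \<Longrightarrow> r = s *\<^sub>R p + t *\<^sub>R q \<Longrightarrow> r \<in> cone2 p q"
  unfolding cone2_def by blast

lemma cone2_generators: "p \<in> cone2 p q" "q \<in> cone2 p q"
  by (rule cone2I[of 1 0], simp_all) (rule cone2I[of 0 1], simp_all)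

lemma cone2_commute: "cone2 p q = cone2 q p"
  unfolding cone2_def by (metis add.commute)

text \<open>Substituting combinations into a combination keeps the coefficients non-negative. This
  is what allows a generator to be exchanged.\<close>

lemma cone2_subset:
  assumes "u \<in> cone2 p q" "v \<in> cone2 p q"
  shows "cone2 u v \<subseteq> cone2 p q"
proof
  fix r assume "r \<in> cone2 u v"
  then obtain s t where st: "0 \<le> s" "0 \<le> t" "r = s *\<^sub>R u + t *\<^sub>R v"
    unfolding cone2_def by blast
  obtain a b where ab: "0 \<le> a" "0 \<le> b" "u = a *\<^sub>R p + b *\<^sub>R q"
    using assms(1) unfolding cone2_def by blast
  obtain c d where cd: "0 \<le> c" "0 \<le> d" "v = c *\<^sub>R p + d *\<^sub>R q"
    using assms(2) unfolding cone2_def by blast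
  show "r \<in> cone2 p q"
    by (rule cone2I[of "s * a + t * c" "s * b + t * d"])
      (use st ab cd in \<open>simp_all add: algebra_simps\<close>)
qed

lemma cone2_planarI:
  fixes x y x1 y1 x2 y2 :: real
  assumes "0 < k" "0 \<le> s" "0 \<le> t" "k * x = s * x1 + t * x2" "k * y = s * y1 + t * y2"
  shows "(x, y) \<in> cone2 (x1, y1) (x2, y2)"
proof (rule cone2I[of "s / k" "t / k"])
  have "x = s / k * x1 + t / k * x2" "y = s / k * y1 + t / k * y2"
    using assms by (simp_all add: field_simps)
  then show "(x, y) = (s / k) *\<^sub>R (x1, y1) + (t / k) *\<^sub>R (x2, y2)"
    by simp
qed (use assms in auto)

text \<open>The three minors are the coefficients of a linear dependence. When one of them has sign
  opposite to the other two, solving for its vector gives a non-negative combination. All remaining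
  sign patterns are degenerate in a quadrant.\<close>

lemma quadrant_three_cases:
  fixes x1 y1 x2 y2 x3 y3 :: real
  assumes nn: "0 \<le> x1" "0 \<le> y1" "0 \<le> x2" "0 \<le> y2" "0 \<le> x3" "0 \<le> y3"
  shows "(x1, y1) \<in> cone2 (x2, y2) (x3, y3) \<or> (x2, y2) \<in> cone2 (x1, y1) (x3, y3) \<or>
    (x3, y3) \<in> cone2 (x1, y1) (x2, y2)"
proof -
  define a where "a = x2 * y3 - x3 * y2"
  define b where "b = x3 * y1 - x1 * y3"
  define c where "c = x1 * y2 - x2 * y1"
  \<comment> \<open>The linear dependence given by the three \<open>2 \<times> 2\<close> minors.\<close>
  have rel: "a * x1 + b * x2 + c * x3 = 0" "a * y1 + b * y2 + c * y3 = 0"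
    by (auto simp: a_def b_def c_def algebra_simps)
  have one: "(x1, y1) \<in> cone2 (x2, y2) (x3, y3)" if "a > 0 \<and> b \<le> 0 \<and> c \<le> 0 \<or> a < 0 \<and> b \<ge> 0 \<and> c \<ge> 0"
    using that
  proof
    assume "a > 0 \<and> b \<le> 0 \<and> c \<le> 0"
    then show ?thesis
      by (intro cone2_planarI[of a "-b" "-c"]) (use rel in auto)
  next
    assume "a < 0 \<and> b \<ge> 0 \<and> c \<ge> 0"
    then show ?thesis
      by (intro cone2_planarI[of "-a" b c]) (use rel in auto)
  qed
  have two: "(x2, y2) \<in> cone2 (x1, y1) (x3, y3)" if "b > 0 \<and> a \<le> 0 \<and> c \<le> 0 \<or> b < 0 \<and> a \<ge> 0 \<and> c \<ge> 0"
    using that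
  proof
    assume "b > 0 \<and> a \<le> 0 \<and> c \<le> 0"
    then show ?thesis
      by (intro cone2_planarI[of b "-a" "-c"]) (use rel in auto)
  next
    assume "b < 0 \<and> a \<ge> 0 \<and> c \<ge> 0"
    then show ?thesis
      by (intro cone2_planarI[of "-b" a c]) (use rel in auto)
  qed
  have three: "(x3, y3) \<in> cone2 (x1, y1) (x2, y2)" if "c > 0 \<and> a \<le> 0 \<and> b \<le> 0 \<or> c < 0 \<and> a \<ge> 0 \<and> b \<ge> 0"
    using that
  proof
    assume "c > 0 \<and> a \<le> 0 \<and> b \<le> 0"
    then show ?thesis
      by (intro cone2_planarI[of c "-a" "-b"]) (use rel in auto)
  next
    assume "c < 0 \<and> a \<ge> 0 \<and> b \<ge> 0"
    then show ?thesis
      by (intro cone2_planarI[of "-c" a b]) (use rel in auto)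
  qed
  have zero: "(x1, y1) \<in> cone2 (x2, y2) (x3, y3) \<or> (x2, y2) \<in> cone2 (x1, y1) (x3, y3)"
    if "c = 0"
  proof (cases "x1 = 0 \<and> y1 = 0")
    case True
    then show ?thesis by (auto intro!: cone2_planarI[of 1 0 0])
  next
    case False
    \<comment> \<open>The two vectors are parallel. On the quadrant the coordinate sum vanishes only
      at the origin, so the ratio of the sums is the factor that takes the first vector to the
      second.\<close>
    then have "x1 + y1 > 0" using nn by auto
    moreover have "x1 * y2 = x2 * y1" using that by (simp add: c_def)
    ultimately have "(x2, y2) \<in> cone2 (x1, y1) (x3, y3)"
      by (intro cone2_planarI[of "x1 + y1" "x2 + y2" 0]) (use nn in \<open>auto simp: algebra_simps\<close>)
    then show ?thesis ..
  qed
  \<comment> \<open>In a vanishing sum of non-negative terms every term is zero. Applied to both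
    coordinates, this excludes three vectors that positively span the plane.\<close>
  have vanish: "r = 0"
    if "h \<ge> 0" "k \<ge> 0" "l > 0" "h * p + k * q + l * r = 0" "p \<ge> 0" "q \<ge> 0" "r \<ge> 0"
    for h k l p q r :: real
  proof -
    have "0 \<le> h * p" "0 \<le> k * q" "0 \<le> l * r" using that by auto
    then have "l * r = 0" using that(4) by linarith
    then show ?thesis using that by auto
  qed
  \<comment> \<open>When the signs agree, the third vector is zero and both minors containing it
    vanish, so the situation falls under \<open>three\<close>; \<open>neg\<close> is the mirror
    image.\<close>
  have pos: "a = 0 \<and> b = 0" if "a \<ge> 0" "b \<ge> 0" "c > 0"
  proof -
    have "x3 = 0" "y3 = 0" using vanish[OF that rel(1)] vanish[OF that rel(2)] nn by blast+
    then show ?thesis by (simp add: a_def b_def)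
  qed
  have neg: "a = 0 \<and> b = 0" if "a \<le> 0" "b \<le> 0" "c < 0"
  proof -
    have "x3 = 0" "y3 = 0"
      using vanish[of "-a" "-b" "-c" x1 x2 x3] vanish[of "-a" "-b" "-c" y1 y2 y3] that rel nn
      by simp_all
    then show ?thesis by (simp add: a_def b_def)
  qed
  have "c = 0 \<or> (a > 0 \<and> b \<le> 0 \<and> c \<le> 0 \<or> a < 0 \<and> b \<ge> 0 \<and> c \<ge> 0) \<or>
    (b > 0 \<and> a \<le> 0 \<and> c \<le> 0 \<or> b < 0 \<and> a \<ge> 0 \<and> c \<ge> 0) \<or>
    (c > 0 \<and> a \<le> 0 \<and> b \<le> 0 \<or> c < 0 \<and> a \<ge> 0 \<and> b \<ge> 0)"
    using pos neg by argo
  then show ?thesis using one two three zero by blast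
qed

text \<open>Induction by exchange of generators. They are named by indices rather than by vectors,
  so \<open>p \<noteq> q\<close> can be had even when vectors coincide; two distinct columns depend
  on it later.\<close>

lemma quadrant_cone_generators:
  fixes x y :: "'a \<Rightarrow> real"
  assumes "finite S" "2 \<le> card S" "\<And>j. j \<in> S \<Longrightarrow> 0 \<le> x j \<and> 0 \<le> y j"
  shows "\<exists>p\<in>S. \<exists>q\<in>S. p \<noteq> q \<and> (\<forall>j\<in>S. (x j, y j) \<in> cone2 (x p, y p) (x q, y q))"
  using assms
proof (induction S rule: finite_induct)
  case empty
  then show ?case by simp
next
  case (insert z F)
  let ?v = "\<lambda>j. (x j, y j)"
  show ?case
  proof (cases "2 \<le> card F")
    case True
    then obtain p q where pq: "p \<in> F" "q \<in> F" "p \<noteq> q"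
      and gen: "\<And>j. j \<in> F \<Longrightarrow> ?v j \<in> cone2 (?v p) (?v q)"
      using insert by auto
    have "z \<noteq> p" "z \<noteq> q" using pq insert.hyps by auto
    \<comment> \<open>Either the new vector lies in the old cone, or it replaces the old generator
      that has become redundant.\<close>
    have "?v z \<in> cone2 (?v p) (?v q) \<or> ?v p \<in> cone2 (?v z) (?v q) \<or> ?v q \<in> cone2 (?v z) (?v p)"
      using insert.prems(2) pq by (intro quadrant_three_cases) auto
    then consider "?v z \<in> cone2 (?v p) (?v q)" | "?v p \<in> cone2 (?v z) (?v q)"
      | "?v q \<in> cone2 (?v z) (?v p)"
      by blast
    then show ?thesis
    proof cases
      case 1
      then have "\<forall>j\<in>insert z F. ?v j \<in> cone2 (?v p) (?v q)" using gen by blast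
      then show ?thesis using pq by blast
    next
      case 2
      then have "\<forall>j\<in>insert z F. ?v j \<in> cone2 (?v z) (?v q)"
        using gen cone2_subset[OF 2 cone2_generators(2)] cone2_generators(1) by blast
      then show ?thesis using pq \<open>z \<noteq> q\<close> by blast
    next
      case 3
      then have "\<forall>j\<in>insert z F. ?v j \<in> cone2 (?v z) (?v p)"
        using gen cone2_subset[OF cone2_generators(2) 3] cone2_generators(1) by blast
      then show ?thesis using pq \<open>z \<noteq> p\<close> by blast
    qed
  next
    case False
    \<comment> \<open>This is the true base of the induction: a two-element set, both of whose
      members are generators.\<close>
    then have "card F = 1" using insert by auto
    then obtain p where "F = {p}" by (auto simp: card_1_singleton_iff)
    then show ?thesis using insert.hyps cone2_generators
      by (intro bexI[of _ z] bexI[of _ p]) auto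
  qed
qed

section \<open>Non-negative rank and factorizations\<close>

text \<open>Taking the generators as columns of \<open>v\<close> and the coefficients as columns of
  \<open>w\<close> turns a generating family into a factorization of the same inner size. Such
  factorizations persist when the size grows, so a bound on the least size amounts to existence at
  the bound.\<close>

lemma nonneg_rank_le_iff:
  assumes P: "P \<in> carrier_mat m n" and nn: "\<And>i j. i < m \<Longrightarrow> j < n \<Longrightarrow> 0 \<le> P $$ (i, j)"
  shows "nonneg_rank P \<le> r \<longleftrightarrow> (\<exists>v w. (\<forall>i<m. \<forall>l<r. 0 \<le> v i l) \<and> (\<forall>l<r. \<forall>j<n. 0 \<le> w l j) \<and>
    (\<forall>i<m. \<forall>j<n. P $$ (i, j) = (\<Sum>l<r. v i l * w l j)))"
    (is "_ \<longleftrightarrow> ?fac r")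
proof -
  define gen where "gen k \<longleftrightarrow> (\<exists>v :: nat \<Rightarrow> real vec.
     (\<forall>l<k. v l \<in> carrier_vec (dim_row P) \<and> 0\<^sub>v (dim_row P) \<le> v l) \<and>
     (\<forall>j<dim_col P. \<exists>w :: nat \<Rightarrow> real. (\<forall>l<k. 0 \<le> w l) \<and>
        col P j = finsum_vec TYPE(real) (dim_row P) (\<lambda>l. w l \<cdot>\<^sub>v v l) {..<k}))" for k
  have rank: "nonneg_rank P = (LEAST k. gen k)"
    unfolding nonneg_rank_def gen_def ..
  have dims: "dim_row P = m" "dim_col P = n" using P by auto
  have gen_fac: "gen k \<longleftrightarrow> ?fac k" for k
  proof
    assume "gen k"
    then obtain v where v: "\<And>l. l < k \<Longrightarrow> v l \<in> carrier_vec m \<and> 0\<^sub>v m \<le> v l"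
      and "\<forall>j<n. \<exists>w :: nat \<Rightarrow> real. (\<forall>l<k. 0 \<le> w l) \<and>
        col P j = finsum_vec TYPE(real) m (\<lambda>l. w l \<cdot>\<^sub>v v l) {..<k}"
      unfolding gen_def dims by blast
    then obtain w :: "nat \<Rightarrow> nat \<Rightarrow> real" where w: "\<And>j l. j < n \<Longrightarrow> l < k \<Longrightarrow> 0 \<le> w j l"
      and eq: "\<And>j. j < n \<Longrightarrow> col P j = finsum_vec TYPE(real) m (\<lambda>l. w j l \<cdot>\<^sub>v v l) {..<k}"
      by metis
    have "P $$ (i, j) = (\<Sum>l<k. v l $ i * w j l)" if "i < m" "j < n" for i j
    proof -
      have "P $$ (i, j) = col P j $ i" using that dims by simp
      also have "\<dots> = (\<Sum>l<k. (w j l \<cdot>\<^sub>v v l) $ i)"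
        unfolding eq[OF that(2)] by (rule index_finsum_vec) (use that v in auto)
      also have "\<dots> = (\<Sum>l<k. v l $ i * w j l)"
      proof (rule sum.cong)
        fix l assume "l \<in> {..<k}"
        then have "dim_vec (v l) = m" using v by auto
        then show "(w j l \<cdot>\<^sub>v v l) $ i = v l $ i * w j l" using that by simp
      qed simp
      finally show ?thesis .
    qed
    moreover have "0 \<le> v l $ i" if "i < m" "l < k" for i l
    proof -
      have "dim_vec (v l) = m" "0\<^sub>v m \<le> v l" using v[OF that(2)] by auto
      then show ?thesis using that(1) by (simp add: less_eq_vec_def)
    qed
    ultimately show "?fac k"
      using w by (intro exI[of _ "\<lambda>i l. v l $ i"] exI[of _ "\<lambda>l j. w j l"] conjI allI impI)
  next
    assume "?fac k"
    then obtain v w where vw: "\<And>i l. i < m \<Longrightarrow> l < k \<Longrightarrow> 0 \<le> v i l"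
      "\<And>l j. l < k \<Longrightarrow> j < n \<Longrightarrow> 0 \<le> w l j"
      "\<And>i j. i < m \<Longrightarrow> j < n \<Longrightarrow> P $$ (i, j) = (\<Sum>l<k. v i l * w l j)"
      by blast
    have "col P j = finsum_vec TYPE(real) m (\<lambda>l. w l j \<cdot>\<^sub>v vec m (\<lambda>i. v i l)) {..<k}"
      (is "_ = ?s") if "j < n" for j
    proof (rule eq_vecI)
      have "?s \<in> carrier_vec m" by (rule finsum_vec_closed) auto
      then have dim_s: "dim_vec ?s = m" by simp
      then show "dim_vec (col P j) = dim_vec ?s" by (simp add: dims)
      fix i assume "i < dim_vec ?s"
      then have i: "i < m" using dim_s by simp
      have "?s $ i = (\<Sum>l<k. (w l j \<cdot>\<^sub>v vec m (\<lambda>i. v i l)) $ i)"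
        by (rule index_finsum_vec) (use i in auto)
      then show "col P j $ i = ?s $ i"
        using i that dims vw(3)[OF i that] by (simp add: mult.commute)
    qed
    then show "gen k"
      unfolding gen_def dims
      by (intro exI[of _ "\<lambda>l. vec m (\<lambda>i. v i l)"] conjI allI impI exI[of _ "\<lambda>l. w l _"])
        (simp_all add: less_eq_vec_def vw(1,2))
  qed
  have mono: "?fac r" if fac: "?fac k" and kr: "k \<le> r" for k
  proof -
    obtain v w where vw: "\<And>i l. i < m \<Longrightarrow> l < k \<Longrightarrow> 0 \<le> v i l"
      "\<And>l j. l < k \<Longrightarrow> j < n \<Longrightarrow> 0 \<le> w l j"
      "\<And>i j. i < m \<Longrightarrow> j < n \<Longrightarrow> P $$ (i, j) = (\<Sum>l<k. v i l * w l j)"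
      using fac by blast
    \<comment> \<open>Inner indices from \<open>k\<close> on get zero in both factors, which keeps
      non-negativity and changes no entry.\<close>
    have padded: "P $$ (i, j) =
        (\<Sum>l<r. (if l < k then v i l else 0) * (if l < k then w l j else 0))"
      if "i < m" "j < n" for i j
      unfolding vw(3)[OF that] using kr by (intro sum.mono_neutral_cong_left) auto
    show ?thesis
      by (rule exI[of _ "\<lambda>i l. if l < k then v i l else 0"],
          rule exI[of _ "\<lambda>l j. if l < k then w l j else 0"])
        (simp add: vw(1,2) padded)
  qed
  \<comment> \<open>The columns of \<open>P\<close> are generators, so \<open>LEAST\<close> ranges over a nonempty set.\<close>
  have "?fac n"
    by (rule exI[of _ "\<lambda>i l. P $$ (i, l)"], rule exI[of _ "\<lambda>l j. if l = j then 1 else 0"])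
      (simp add: nn if_distrib[of "\<lambda>x. _ * x"] cong: if_cong)
  then have "gen (nonneg_rank P)"
    unfolding rank gen_fac[symmetric] by (rule LeastI)
  then have least: "?fac (nonneg_rank P)" unfolding gen_fac .
  show ?thesis
  proof
    assume "nonneg_rank P \<le> r"
    then show "?fac r" using mono least by blast
  next
    assume "?fac r"
    then show "nonneg_rank P \<le> r" unfolding rank gen_fac[symmetric] by (rule Least_le)
  qed
qed

section \<open>Free column indices and their positions\<close>

lemma finite_col_indices [simp]: "finite (col_indices J j1 j2)"
  by (simp add: col_indices_def)

lemma sum_col_indices:
  fixes g :: "nat \<Rightarrow> real"
  assumes "j1 < j2" "j2 < J"
  shows "(\<Sum>j<J. g j) = g j1 + g j2 + (\<Sum>j\<in>col_indices J j1 j2. g j)"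
proof -
  have "(\<Sum>j<J. g j) = g j1 + (\<Sum>j\<in>{..<J} - {j1}. g j)"
    using assms by (intro sum.remove) auto
  also have "(\<Sum>j\<in>{..<J} - {j1}. g j) = g j2 + (\<Sum>j\<in>{..<J} - {j1} - {j2}. g j)"
    using assms by (intro sum.remove) auto
  also have "{..<J} - {j1} - {j2} = col_indices J j1 j2"
    by (auto simp: col_indices_def)
  finally show ?thesis by (simp add: add.assoc)
qed

lemma card_col_indices:
  assumes "j1 < j2" "j2 < J"
  shows "card (col_indices J j1 j2) = J - 2"
  unfolding col_indices_def using assms by (subst card_Diff_subset) auto

text \<open>The counted set omits \<open>j\<close> itself, hence is a proper subset of the
  \<open>J - 2\<close> free indices; positions therefore stay inside their block.\<close>

lemma col_pos_less:
  assumes "j1 < j2" "j2 < J" "j \<in> col_indices J j1 j2"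
  shows "col_pos J j1 j2 j < J - 2"
proof -
  have "col_pos J j1 j2 j < card (col_indices J j1 j2)"
    unfolding col_pos_def using assms(3) by (intro psubset_card_mono) auto
  then show ?thesis using card_col_indices[OF assms(1,2)] by simp
qed

text \<open>A larger index also counts the smaller one, so positions increase strictly.\<close>

lemma inj_on_col_pos: "inj_on (col_pos J j1 j2) (col_indices J j1 j2)"
proof (rule linorder_inj_onI)
  fix j k assume "j < k" "j \<in> col_indices J j1 j2" "k \<in> col_indices J j1 j2"
  then have "col_pos J j1 j2 j < col_pos J j1 j2 k"
    unfolding col_pos_def by (intro psubset_card_mono) auto
  then show "col_pos J j1 j2 j \<noteq> col_pos J j1 j2 k" by simp
qed auto

section \<open>Entries of the parametrized matrices\<close>

lemma outer_product_index:
  assumes "i < dim_vec u" "j < dim_vec v"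
  shows "outer_product u v $$ (i, j) = u $ i * v $ j"
  using assms by (simp add: outer_product_def mat_of_row_def scalar_prod_def)

lemma outer_product_carrier: "outer_product u v \<in> carrier_mat (dim_vec u) (dim_vec v)"
  unfolding outer_product_def by (rule mult_carrier_mat[of _ _ 1]) auto

lemma dim_vecs [simp]:
  "dim_vec (vec_a I x) = I" "dim_vec (vec_b I J j1 j2 x) = J"
  "dim_vec (vec_c I J x) = I" "dim_vec (vec_d I J j1 j2 x) = J"
  by (simp_all add: vec_a_def vec_b_def vec_c_def vec_d_def)

lemma f_map_carrier: "f_map I J j1 j2 x \<in> carrier_mat I J"
  unfolding f_map_def
  using outer_product_carrier[of "vec_a I x" "vec_b I J j1 j2 x"]
    outer_product_carrier[of "vec_c I J x" "vec_d I J j1 j2 x"]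
  by auto

lemma f_map_index:
  assumes "i < I" "j < J"
  shows "f_map I J j1 j2 x $$ (i, j) =
    coord_alpha I J x * (vec_a I x $ i * vec_b I J j1 j2 x $ j) +
    (1 - coord_alpha I J x) * (vec_c I J x $ i * vec_d I J j1 j2 x $ j)"
  using assms outer_product_carrier[of "vec_a I x" "vec_b I J j1 j2 x"]
    outer_product_carrier[of "vec_c I J x" "vec_d I J j1 j2 x"]
  unfolding f_map_def by (auto simp: outer_product_index)

section \<open>Probability vectors and the inclusion of the images\<close>

definition stochastic :: "nat \<Rightarrow> (nat \<Rightarrow> real) \<Rightarrow> bool" where
  "stochastic n g \<longleftrightarrow> (\<forall>i<n. 0 \<le> g i) \<and> (\<Sum>i<n. g i) = 1"

text \<open>Non-negativity makes a partial sum at most the total. With singletons included, this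
  yields the constraints in \<open>U'\<close> on the four families and on their sums.\<close>

lemma stochastic_sum_le_1:
  assumes "stochastic n g" "A \<subseteq> {..<n}"
  shows "sum g A \<in> {0..1}"
proof -
  have "0 \<le> sum g A" using assms by (intro sum_nonneg) (auto simp: stochastic_def)
  moreover have "sum g A \<le> (\<Sum>i<n. g i)"
    using assms by (intro sum_mono2) (auto simp: stochastic_def)
  ultimately show ?thesis using assms by (simp add: stochastic_def)
qed

lemma stochastic_le_1:
  assumes "stochastic n g" "i < n"
  shows "g i \<in> {0..1}"
  using stochastic_sum_le_1[OF assms(1), of "{i}"] assms(2) by simp

text \<open>The completing entry is non-negative because \<open>U'\<close> bounds the sum of the
  free coordinates by 1.\<close>

lemma stochastic_vec_a:
  assumes "x \<in> U' I J j1 j2" "0 < I"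
  shows "stochastic I (\<lambda>i. vec_a I x $ i)"
proof -
  \<comment> \<open>\<open>I = Suc n\<close> replaces the truncated \<open>I - 1\<close> by
    \<open>n\<close> and splits off the completing entry as last summand.\<close>
  obtain n where n: "I = Suc n" using assms(2) gr0_implies_Suc by blast
  have "(\<Sum>i<n. vec_a I x $ i) = (\<Sum>i<n. coord_a x i)"
    by (intro sum.cong) (auto simp: vec_a_def n)
  then show ?thesis
    using assms(1) by (auto simp: stochastic_def U'_def vec_a_def n)
qed

lemma stochastic_vec_c:
  assumes "x \<in> U' I J j1 j2" "0 < I"
  shows "stochastic I (\<lambda>i. vec_c I J x $ i)"
proof -
  obtain n where n: "I = Suc n" using assms(2) gr0_implies_Suc by blast
  have "(\<Sum>i<n. vec_c I J x $ i) = (\<Sum>i<n. coord_c I J x i)"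
    by (intro sum.cong) (auto simp: vec_c_def n)
  then show ?thesis
    using assms(1) by (auto simp: stochastic_def U'_def vec_c_def n)
qed

lemma stochastic_vec_b:
  assumes "x \<in> U' I J j1 j2" "j1 < j2" "j2 < J"
  shows "stochastic J (\<lambda>j. vec_b I J j1 j2 x $ j)"
proof -
  have "(\<Sum>j\<in>col_indices J j1 j2. vec_b I J j1 j2 x $ j) =
      (\<Sum>j\<in>col_indices J j1 j2. coord_b I J j1 j2 x j)"
    by (intro sum.cong) (auto simp: vec_b_def col_indices_def)
  moreover have "0 \<le> vec_b I J j1 j2 x $ j" if "j < J" for j
    using assms that by (auto simp: U'_def vec_b_def col_indices_def)
  moreover have "vec_b I J j1 j2 x $ j1 = 1 - (\<Sum>j\<in>col_indices J j1 j2. coord_b I J j1 j2 x j)"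
    "vec_b I J j1 j2 x $ j2 = 0"
    using assms(2,3) by (simp_all add: vec_b_def)
  ultimately show ?thesis
    by (simp add: stochastic_def sum_col_indices[OF assms(2,3)])
qed

lemma stochastic_vec_d:
  assumes "x \<in> U' I J j1 j2" "j1 < j2" "j2 < J"
  shows "stochastic J (\<lambda>j. vec_d I J j1 j2 x $ j)"
proof -
  have "(\<Sum>j\<in>col_indices J j1 j2. vec_d I J j1 j2 x $ j) =
      (\<Sum>j\<in>col_indices J j1 j2. coord_d I J j1 j2 x j)"
    by (intro sum.cong) (auto simp: vec_d_def col_indices_def)
  moreover have "0 \<le> vec_d I J j1 j2 x $ j" if "j < J" for j
    using assms that by (auto simp: U'_def vec_d_def col_indices_def)
  moreover have "vec_d I J j1 j2 x $ j1 = 0"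
    "vec_d I J j1 j2 x $ j2 = 1 - (\<Sum>j\<in>col_indices J j1 j2. coord_d I J j1 j2 x j)"
    using assms(2,3) by (simp_all add: vec_d_def)
  ultimately show ?thesis
    by (simp add: stochastic_def sum_col_indices[OF assms(2,3)])
qed

text \<open>The matrix is a convex combination of two outer products of probability vectors. Each
  product has total mass 1, and having two of them bounds the rank.\<close>

lemma f_map_in_mixture_set:
  assumes x: "x \<in> U' I J j1 j2" and j: "j1 < j2" "j2 < J" and "0 < I"
  shows "f_map I J j1 j2 x \<in> mixture_set I J"
proof -
  define \<alpha> a b c d where abcd: "\<alpha> = coord_alpha I J x"
    "a = (\<lambda>i. vec_a I x $ i)" "b = (\<lambda>j. vec_b I J j1 j2 x $ j)"
    "c = (\<lambda>i. vec_c I J x $ i)" "d = (\<lambda>j. vec_d I J j1 j2 x $ j)"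
  let ?P = "f_map I J j1 j2 x"
  have st: "stochastic I a" "stochastic J b" "stochastic I c" "stochastic J d"
    unfolding abcd using assms stochastic_vec_a stochastic_vec_b stochastic_vec_c stochastic_vec_d
    by blast+
  have \<alpha>: "0 \<le> \<alpha>" "\<alpha> \<le> 1" using x by (auto simp: U'_def abcd)
  have P: "?P $$ (i, j) = \<alpha> * (a i * b j) + (1 - \<alpha>) * (c i * d j)" if "i < I" "j < J" for i j
    unfolding abcd by (rule f_map_index[OF that])
  have nn: "0 \<le> ?P $$ (i, j)" if "i < I" "j < J" for i j
    using that st \<alpha> unfolding P[OF that] stochastic_def by simp
  \<comment> \<open>Inner index 0 stands for the first product and 1 for the second; the weights are
    put into the left factors.\<close>
  have "nonneg_rank ?P \<le> 2"
    by (rule iffD2[OF nonneg_rank_le_iff[OF f_map_carrier nn]], assumption, assumption,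
        rule exI[of _ "\<lambda>i l. if l = 0 then \<alpha> * a i else (1 - \<alpha>) * c i"],
        rule exI[of _ "\<lambda>l j. if l = 0 then b j else d j"])
      (use st \<alpha> in \<open>auto simp: P stochastic_def numeral_2_eq_2\<close>)
  moreover have "(\<Sum>i<I. \<Sum>j<J. ?P $$ (i, j)) =
      \<alpha> * ((\<Sum>i<I. a i) * (\<Sum>j<J. b j)) + (1 - \<alpha>) * ((\<Sum>i<I. c i) * (\<Sum>j<J. d j))"
    unfolding sum_product by (simp add: P sum_distrib_left sum.distrib)
  ultimately show ?thesis
    using st nn f_map_carrier by (auto simp: mixture_set_def stochastic_def)
qed

section \<open>Parameters of a prescribed mixture\<close>

text \<open>The parameters arise by dropping the completing entries and the forced zeros;
  normalization restores what was dropped. The conditions on \<open>b j2\<close> and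
  \<open>d j1\<close> are those built into \<open>f_map\<close>.\<close>

lemma f_map_attains:
  assumes j: "j1 < j2" "j2 < J" and "0 < I" and \<alpha>: "0 \<le> \<alpha>" "\<alpha> \<le> 1"
    and st: "stochastic I a" "stochastic J b" "stochastic I c" "stochastic J d"
    and zero: "b j2 = 0" "d j1 = 0"
  shows "\<exists>x\<in>U' I J j1 j2. \<forall>i<I. \<forall>j<J.
    f_map I J j1 j2 x $$ (i, j) = \<alpha> * (a i * b j) + (1 - \<alpha>) * (c i * d j)"
proof -
  define N where "N = col_indices J j1 j2"
  \<comment> \<open>\<open>e\<close> recovers a free column index from its position, so that blocks
    of coordinates can be filled from families indexed by columns.\<close>
  define e where "e = inv_into N (col_pos J j1 j2)"
  define m n where "m = I - 1" and "n = J - 2"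
  define x where "x = vec (2 * I + 2 * J - 5) (\<lambda>k.
    if k < m then a k else if k < m + n then b (e (k - m))
    else if k < m + n + m then c (k - (m + n))
    else if k < m + n + m + n then d (e (k - (m + n + m))) else \<alpha>)"
  \<comment> \<open>The subtractions do not truncate: \<open>I = m + 1\<close> and
    \<open>J = n + 2\<close>, which leaves \<open>2 * m + 2 * n + 1\<close> coordinates.\<close>
  have dim: "2 * I + 2 * J - 5 = Suc (m + n + m + n)" and I: "I = Suc m"
    using assms unfolding m_def n_def by auto
  have e: "e (col_pos J j1 j2 k) = k" if "k \<in> N" for k
    using that inj_on_col_pos unfolding e_def N_def by simp
  have pos: "col_pos J j1 j2 k < n" if "k \<in> N" for k
    using col_pos_less[OF j] that unfolding N_def n_def by blast
  have A: "coord_a x k = a k" if "k < m" for k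
    using that by (simp add: coord_a_def x_def dim)
  have B: "coord_b I J j1 j2 x k = b k" if "k \<in> N" for k
    using that pos[OF that] e[OF that]
    unfolding coord_b_def m_def[symmetric] n_def[symmetric] by (simp add: x_def dim)
  have C: "coord_c I J x k = c k" if "k < m" for k
    using that unfolding coord_c_def m_def[symmetric] n_def[symmetric] by (simp add: x_def dim)
  have D: "coord_d I J j1 j2 x k = d k" if "k \<in> N" for k
    using that pos[OF that] e[OF that]
    unfolding coord_d_def m_def[symmetric] n_def[symmetric] by (simp add: x_def dim)
  have AL: "coord_alpha I J x = \<alpha>"
    unfolding coord_alpha_def m_def[symmetric] n_def[symmetric] by (simp add: x_def dim)
  have N: "N \<subseteq> {..<J}" "\<And>k. k < J \<Longrightarrow> k \<noteq> j1 \<Longrightarrow> k \<noteq> j2 \<Longrightarrow> k \<in> N"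
    by (auto simp: N_def col_indices_def)
  have sums: "(\<Sum>k<m. coord_a x k) = sum a {..<m}" "(\<Sum>k<m. coord_c I J x k) = sum c {..<m}"
    "(\<Sum>k\<in>N. coord_b I J j1 j2 x k) = sum b N" "(\<Sum>k\<in>N. coord_d I J j1 j2 x k) = sum d N"
    using A B C D by simp_all
  have "x \<in> U' I J j1 j2"
    unfolding U'_def m_def[symmetric] N_def[symmetric] mem_Collect_eq sums AL
    using \<alpha> N st A B C D stochastic_le_1 stochastic_sum_le_1
    by (auto simp: x_def I subset_eq)
  moreover have "vec_a I x $ i = a i" "vec_c I J x $ i = c i" if "i < I" for i
    using that st(1,3) A C sums(1,2) by (auto simp: vec_a_def vec_c_def stochastic_def I less_Suc_eq)
  \<comment> \<open>With a zero at \<open>j2\<close> for \<open>b\<close> and at \<open>j1\<close>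
    for \<open>d\<close>, total mass 1 determines the other distinguished entry.\<close>
  moreover have "vec_b I J j1 j2 x $ k = b k" "vec_d I J j1 j2 x $ k = d k" if "k < J" for k
    using that st(2,4) B D N sums(3,4) zero j sum_col_indices[OF j, of b] sum_col_indices[OF j, of d]
    by (auto simp: vec_b_def vec_d_def stochastic_def N_def)
  ultimately show ?thesis
    by (intro bexI[of _ x]) (simp_all add: f_map_index AL)
qed

section \<open>Decomposition of a given matrix\<close>

text \<open>Division by the total mass works unless that mass is zero; then the family itself
  vanishes and any probability vector serves.\<close>

lemma stochastic_normalize:
  assumes "0 < n" "\<And>i. i < n \<Longrightarrow> 0 \<le> g i"
  obtains h where "stochastic n h" "\<And>i. i < n \<Longrightarrow> g i = (\<Sum>k<n. g k) * h i"
proof (cases "(\<Sum>k<n. g k) = 0")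
  case True
  then have "\<forall>i<n. g i = 0"
    using assms(2) by (subst (asm) sum_nonneg_eq_0_iff) auto
  \<comment> \<open>The point mass at 0 is an arbitrary choice, available since
    \<open>0 < n\<close>.\<close>
  then show ?thesis
    using True assms(1) by (intro that[of "\<lambda>i. if i = 0 then 1 else 0"]) (auto simp: stochastic_def)
next
  case False
  moreover have "0 \<le> (\<Sum>k<n. g k)" using assms(2) by (intro sum_nonneg) auto
  ultimately show ?thesis
    using assms(2) by (intro that[of "\<lambda>i. g i / (\<Sum>k<n. g k)"])
      (auto simp: stochastic_def sum_divide_distrib[symmetric])
qed

text \<open>In a factorization of inner size 2 the columns of \<open>P\<close> are the images of
  coefficient pairs under one linear map, so conic relations between pairs in the quadrant carry
  over to the columns.\<close>

lemma column_generators: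
  assumes P: "P \<in> mixture_set I J" and J: "2 \<le> J"
  obtains j1 j2 s t where "j1 < j2" "j2 < J" "\<And>j. j < J \<Longrightarrow> 0 \<le> s j \<and> 0 \<le> t j"
    "s j2 = 0" "t j1 = 0" "s j1 = 1" "t j2 = (1::real)"
    "\<And>i j. i < I \<Longrightarrow> j < J \<Longrightarrow> P $$ (i, j) = P $$ (i, j1) * s j + P $$ (i, j2) * t j"
proof -
  have carrier: "P \<in> carrier_mat I J" and nn: "\<And>i j. i < I \<Longrightarrow> j < J \<Longrightarrow> 0 \<le> P $$ (i, j)"
    and "nonneg_rank P \<le> 2"
    using P by (auto simp: mixture_set_def)
  then obtain v w :: "nat \<Rightarrow> nat \<Rightarrow> real" where w: "\<forall>l<2. \<forall>j<J. 0 \<le> w l j"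
    and "\<forall>i<I. \<forall>j<J. P $$ (i, j) = (\<Sum>l<2. v i l * w l j)"
    using iffD1[OF nonneg_rank_le_iff[OF carrier nn]] by blast
  then have fac: "P $$ (i, j) = v i 0 * w 0 j + v i 1 * w 1 j" if "i < I" "j < J" for i j
    using that by (simp add: numeral_2_eq_2)
  have "\<exists>p\<in>{..<J}. \<exists>q\<in>{..<J}. p \<noteq> q \<and>
      (\<forall>j\<in>{..<J}. (w 0 j, w 1 j) \<in> cone2 (w 0 p, w 1 p) (w 0 q, w 1 q))"
    using w J by (intro quadrant_cone_generators) auto
  then obtain p q where pq: "p < J" "q < J" "p \<noteq> q"
    and gen: "\<And>j. j < J \<Longrightarrow> (w 0 j, w 1 j) \<in> cone2 (w 0 p, w 1 p) (w 0 q, w 1 q)"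
    by auto
  \<comment> \<open>Swapping the generators leaves the cone unchanged, so their indices may be put
    in increasing order.\<close>
  obtain j1 j2 where j: "j1 < j2" "j2 < J"
    and gen': "\<And>j. j < J \<Longrightarrow> (w 0 j, w 1 j) \<in> cone2 (w 0 j1, w 1 j1) (w 0 j2, w 1 j2)"
  proof (cases "p < q")
    case True
    then show ?thesis using that[of p q] pq gen by blast
  next
    case False
    then have "q < p" using pq(3) by simp
    moreover have "\<And>j. j < J \<Longrightarrow> (w 0 j, w 1 j) \<in> cone2 (w 0 q, w 1 q) (w 0 p, w 1 p)"
      using gen by (simp add: cone2_commute)
    ultimately show ?thesis using that[of q p] pq by blast
  qed
  have "\<exists>s t. 0 \<le> s \<and> 0 \<le> t \<and> w 0 j = s * w 0 j1 + t * w 0 j2 \<and>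
      w 1 j = s * w 1 j1 + t * w 1 j2" if "j < J" for j
    using gen'[OF that] by (auto simp: cone2_def)
  then obtain s t where st: "\<And>j. j < J \<Longrightarrow> 0 \<le> s j \<and> 0 \<le> t j \<and>
      w 0 j = s j * w 0 j1 + t j * w 0 j2 \<and> w 1 j = s j * w 1 j1 + t j * w 1 j2"
    by metis
  \<comment> \<open>The coefficients found for the generators themselves need not be unique.
    Overwriting them by 0 and 1 produces the zeros required of \<open>b\<close> and \<open>d\<close>
    and keeps both coefficient sums positive.\<close>
  define s' where "s' = s(j1 := 1, j2 := 0)"
  define t' where "t' = t(j1 := 0, j2 := 1)"
  show ?thesis
  proof (rule that[OF j, of s' t'])
    show "P $$ (i, k) = P $$ (i, j1) * s' k + P $$ (i, j2) * t' k" if "i < I" "k < J" for i k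
    proof (cases "k = j1 \<or> k = j2")
      case True
      then show ?thesis using j by (auto simp: s'_def t'_def)
    next
      case False
      have "P $$ (i, k) = v i 0 * (s k * w 0 j1 + t k * w 0 j2) + v i 1 * (s k * w 1 j1 + t k * w 1 j2)"
        using st[OF that(2)] unfolding fac[OF that] by simp
      also have "\<dots> = P $$ (i, j1) * s k + P $$ (i, j2) * t k"
        using fac[of i j1] fac[of i j2] that j by (simp add: algebra_simps)
      finally show ?thesis using False by (simp add: s'_def t'_def)
    qed
  qed (use j st in \<open>auto simp: s'_def t'_def\<close>)
qed

text \<open>With column masses \<open>A\<close>, \<open>C\<close> and coefficient masses
  \<open>S\<close>, \<open>T\<close>, normalization puts the weights \<open>A * S\<close> and
  \<open>C * T\<close> on the two outer products; total mass 1 makes these weights convex.\<close>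

lemma mixture_set_in_image:
  assumes P: "P \<in> mixture_set I J" and "0 < I" "2 \<le> J"
  shows "\<exists>j1 j2. j1 < j2 \<and> j2 < J \<and> P \<in> f_map I J j1 j2 ` U' I J j1 j2"
proof -
  obtain j1 j2 s t where j: "j1 < j2" "j2 < J" and st: "\<And>j. j < J \<Longrightarrow> 0 \<le> s j \<and> 0 \<le> t j"
    and s: "s j2 = 0" "s j1 = 1" and t: "t j1 = 0" "t j2 = (1::real)"
    and P_eq: "\<And>i j. i < I \<Longrightarrow> j < J \<Longrightarrow> P $$ (i, j) = P $$ (i, j1) * s j + P $$ (i, j2) * t j"
    using column_generators[OF P \<open>2 \<le> J\<close>] by metis
  have P_nn: "0 \<le> P $$ (i, j)" if "i < I" "j < J" for i j
    using P that by (auto simp: mixture_set_def)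
  define A where "A = (\<Sum>i<I. P $$ (i, j1))"
  define C where "C = (\<Sum>i<I. P $$ (i, j2))"
  define S where "S = (\<Sum>j<J. s j)"
  define T where "T = (\<Sum>j<J. t j)"
  \<comment> \<open>The unit coefficients make \<open>S\<close> and \<open>T\<close> positive, so
    they can be cancelled when the zeros of \<open>s\<close> and \<open>t\<close> pass to
    \<open>b\<close> and \<open>d\<close>.\<close>
  have "s j1 \<le> S" "t j2 \<le> T"
    unfolding S_def T_def using j st by (auto intro!: member_le_sum)
  then have pos: "0 < S" "0 < T" using s t by auto
  have nn: "0 \<le> A" "0 \<le> C" unfolding A_def C_def using P_nn j by (auto intro!: sum_nonneg)
  \<comment> \<open>A generating column may be zero; its mass is then 0 and the probability vector
    attached to it is arbitrary.\<close>
  obtain a where a: "stochastic I a" "\<And>i. i < I \<Longrightarrow> P $$ (i, j1) = A * a i"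
    using stochastic_normalize[of I "\<lambda>i. P $$ (i, j1)"] P_nn j \<open>0 < I\<close> unfolding A_def by auto
  obtain c where c: "stochastic I c" "\<And>i. i < I \<Longrightarrow> P $$ (i, j2) = C * c i"
    using stochastic_normalize[of I "\<lambda>i. P $$ (i, j2)"] P_nn j \<open>0 < I\<close> unfolding C_def by auto
  obtain b where b: "stochastic J b" "\<And>j. j < J \<Longrightarrow> s j = S * b j"
    using stochastic_normalize[of J s] st \<open>2 \<le> J\<close> unfolding S_def by auto
  obtain d where d: "stochastic J d" "\<And>j. j < J \<Longrightarrow> t j = T * d j"
    using stochastic_normalize[of J t] st \<open>2 \<le> J\<close> unfolding T_def by auto
  have zero: "b j2 = 0" "d j1 = 0" using b(2)[of j2] d(2)[of j1] pos s t j by auto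
  have "1 = (\<Sum>i<I. \<Sum>j<J. P $$ (i, j))" using P by (simp add: mixture_set_def)
  also have "\<dots> = (\<Sum>i<I. \<Sum>j<J. P $$ (i, j1) * s j + P $$ (i, j2) * t j)"
    by (intro sum.cong refl P_eq) auto
  also have "\<dots> = A * S + C * T"
    unfolding A_def C_def S_def T_def by (simp add: sum_product sum.distrib)
  finally have total: "C * T = 1 - A * S" by simp
  moreover have "0 \<le> A * S" "0 \<le> C * T" using nn pos by auto
  \<comment> \<open>\<open>A * S\<close> takes the role of \<alpha>; it is at most 1 because
    \<open>C * T\<close> is non-negative.\<close>
  ultimately obtain x where x: "x \<in> U' I J j1 j2" "\<forall>i<I. \<forall>j<J.
      f_map I J j1 j2 x $$ (i, j) = A * S * (a i * b j) + (1 - A * S) * (c i * d j)"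
    using f_map_attains[OF j \<open>0 < I\<close> _ _ a(1) b(1) c(1) d(1) zero, of "A * S"] by auto
  have "P = f_map I J j1 j2 x"
  proof (rule eq_matI)
    fix i k assume "i < dim_row (f_map I J j1 j2 x)" "k < dim_col (f_map I J j1 j2 x)"
    then have ik: "i < I" "k < J" using f_map_carrier[of I J j1 j2 x] by auto
    have "P $$ (i, k) = A * a i * (S * b k) + C * c i * (T * d k)"
      using P_eq[OF ik] a(2)[OF ik(1)] c(2)[OF ik(1)] b(2)[OF ik(2)] d(2)[OF ik(2)] by simp
    also have "\<dots> = A * S * (a i * b k) + C * T * (c i * d k)" by (simp add: algebra_simps)
    finally show "P $$ (i, k) = f_map I J j1 j2 x $$ (i, k)" using x(2) ik total by simp
  qed (use P f_map_carrier[of I J j1 j2 x] in \<open>auto simp: mixture_set_def\<close>)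
  then show ?thesis using x(1) j by blast
qed

theorem corollary3p4:
  fixes I J :: nat
  assumes "2 \<le> I" and "I \<le> J"
  shows "(\<Union>(j1, j2) \<in> {(j1, j2). j1 < j2 \<and> j2 < J}. f_map I J j1 j2 ` U' I J j1 j2)
           = mixture_set I J"
proof (intro equalityI subsetI)
  fix P assume "P \<in> (\<Union>(j1, j2) \<in> {(j1, j2). j1 < j2 \<and> j2 < J}. f_map I J j1 j2 ` U' I J j1 j2)"
  then show "P \<in> mixture_set I J"
    using assms by (auto intro!: f_map_in_mixture_set)
next
  fix P assume "P \<in> mixture_set I J"
  then show "P \<in> (\<Union>(j1, j2) \<in> {(j1, j2). j1 < j2 \<and> j2 < J}. f_map I J j1 j2 ` U' I J j1 j2)"
    using mixture_set_in_image[of P I J] assms by auto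
qed

end
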